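(* Let $v=(v^i)$ be a smooth vector field on $M=\mathbb{R}^n$ and $\sigma=(\sigma^{ij})$ a smooth function on $\mathbb{R}^n$ with values in invertible $n\times n$ matrices; put $a=\sigma\sigma^T$ and equip $M$ with the Riemannian metric $g_{ij}=(a^{-1})_{ij}$ (inverse $g^{ij}=a^{ij}$). Let $\mathrm{d}_I$ be the Itô–Stratonovich differential on $M\times\mathbb{R}$ defined in the context (diffusion with metric $g$ and drift $-v$). Then the 1-form $$\xi=g_{ij}v^j\,\mathrm{d}_Ix^i+\tfrac12\,g_{ij}v^iv^j\,\mathrm{d}t$$ satisfies $\mathrm{d}_I\xi=0$ if and only if both of the following hold for all indices $k$ and $i,l$: $$\tfrac12 g^{mn}\frac{\partial^2}{\partial x^n\partial x^m}\big(g_{kj}v^j\big)=-\tfrac12\frac{\partial g^{mn}}{\partial x^k}\frac{\partial}{\partial x^n}\big(g_{mj}v^j\big)+\tfrac12 g_{ij}v^j\frac{\partial v^i}{\partial x^k}+\tfrac12 v^i\frac{\partial}{\partial x^i}\big(g_{kj}v^j\big)-\frac{\partial}{\partial t}\big(g_{kj}v^j\big),$$ $$0=\frac{\partial}{\partial x^l}\big(g_{ij}v^j\big)-\frac{\partial}{\partial x^i}\big(g_{lj}v^j\big).$$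
   Context: Summation over repeated indices is understood (for coordinates $x^i$ on $\mathbb{R}^n$; $t$ is the coordinate of the extra factor $\mathbb{R}$). $v,\sigma,g$ are regarded as functions on $\mathbb{R}^n\times\mathbb{R}$. For a time-dependent $r$-form $\omega$ on $M$ (a form on $M\times\mathbb{R}$ without $\mathrm{d}t$ component), $\mathrm{d}\omega$ is the exterior derivative on $M$ at fixed $t$, and $$\mathrm{d}_I\omega=\mathrm{d}\omega+(-1)^r\Big(\frac{\partial\omega}{\partial t}+\tfrac12\Delta_{\mathrm{diff}}\,\omega+\Delta_{-v}\,\omega\Big)\wedge \mathrm{d}t,\qquad \mathrm{d}_I(\omega\wedge \mathrm{d}t)=\mathrm{d}\omega\wedge \mathrm{d}t .$$ Here $\Delta_{\mathrm{diff}}=\delta_{\mathrm{diff}}\mathrm{d}+\mathrm{d}\delta_{\mathrm{diff}}$ with $\delta_{\mathrm{diff}}(\omega)=g^{\mu\nu}\,\iota_{\partial/\partial x^\mu}\nabla_\nu\omega$, where $\nabla$ is the Levi-Civita connection of $g$ and $\iota$ is the interior product (e.g. $\iota_{\partial_1}(\mathrm{d}x^1\wedge \mathrm{d}x^2)=\mathrm{d}x^2$, $\iota_{\partial_2}(\mathrm{d}x^1\wedge \mathrm{d}x^2)=-\mathrm{d}x^1$); and $\Delta_{-v}=\delta_{-v}\mathrm{d}+\mathrm{d}\delta_{-v}$ with $\delta_{-v}(\omega)=-\iota_v\omega$. In particular $\mathrm{d}_Ix^i=\mathrm{d}x^i-\big(v^i+\tfrac12g^{lm}\Gamma^i_{lm}\big)\mathrm{d}t$,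 with $\Gamma$ the Christoffel symbols of $g$. The products of functions with 1-forms in the definition of $\xi$ are ordinary products. *)

theory Defs
  imports "HOL-Analysis.Analysis" "HOL-Library.Function_Algebras"
begin

text \<open>Smoothness: \<open>Ck k f\<close> says that \<open>f\<close> is \<open>k\<close> times continuously differentiable on the whole space.\<close>

fun Ck :: "nat \<Rightarrow> ('a::euclidean_space \<Rightarrow> 'b::real_normed_vector) \<Rightarrow> bool" where
  "Ck 0 f \<longleftrightarrow> continuous_on UNIV f"
| "Ck (Suc k) f \<longleftrightarrow> (\<forall>x. f differentiable (at x)) \<and>
     (\<forall>u. Ck k (\<lambda>x. frechet_derivative f (at x) u))"

definition smooth :: "('a::euclidean_space \<Rightarrow> 'b::real_normed_vector) \<Rightarrow> bool" where
  "smooth f \<longleftrightarrow> (\<forall>k. Ck k f)"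

text \<open>Points of \<open>\<real>\<^sup>n \<times> \<real>\<close> are pairs \<open>(x, t)\<close>. The operator \<open>ddir u\<close> differentiates in the
  direction \<open>u\<close> of \<open>\<real>\<^sup>n\<close> at fixed \<open>t\<close>.\<close>

type_synonym 'n pt = "(real^'n) \<times> real"

definition ddir :: "real^'n \<Rightarrow> ('n::finite pt \<Rightarrow> real) \<Rightarrow> 'n pt \<Rightarrow> real" where
  "ddir u f p = frechet_derivative (\<lambda>x. f (x, snd p)) (at (fst p)) u"

definition pdx :: "'n \<Rightarrow> ('n::finite pt \<Rightarrow> real) \<Rightarrow> 'n pt \<Rightarrow> real" where
  "pdx i = ddir (axis i 1)"

definition pdt :: "('n::finite pt \<Rightarrow> real) \<Rightarrow> 'n pt \<Rightarrow> real" where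
  "pdt f p = deriv (\<lambda>s. f (fst p, s)) (snd p)"

text \<open>A time-dependent form on \<open>\<real>\<^sup>n\<close> (a form without \<open>dt\<close> component) is given by its values on
  lists of tangent vectors of \<open>\<real>\<^sup>n\<close>; an \<open>r\<close>-form vanishes on all lists of length other than \<open>r\<close>.
  A general element is thus an inhomogeneous form whose degree \<open>r\<close> part is its restriction to lists
  of length \<open>r\<close>, so that no operator below needs the degree as an argument. Multilinearity and
  alternation are not part of the type. The wedge product is normalised by
  \<open>(\<alpha> \<and> \<beta>)(X, Y) = \<alpha>(X) \<beta>(Y) - \<alpha>(Y) \<beta>(X)\<close> for 1-forms.\<close>

type_synonym 'n tform = "'n pt \<Rightarrow> (real^'n) list \<Rightarrow> real"

definition fun_form :: "('n::finite pt \<Rightarrow> real) \<Rightarrow> 'n tform" where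
  "fun_form f = (\<lambda>p Xs. if Xs = [] then f p else 0)"

definition ext_d :: "'n::finite tform \<Rightarrow> 'n tform" where
  "ext_d \<omega> = (\<lambda>p Xs. \<Sum>j<length Xs.
     (-1)^j * ddir (Xs ! j) (\<lambda>q. \<omega> q (take j Xs @ drop (Suc j) Xs)) p)"

definition interior_prod :: "('n::finite pt \<Rightarrow> real^'n) \<Rightarrow> 'n tform \<Rightarrow> 'n tform" where
  "interior_prod w \<omega> = (\<lambda>p Xs. \<omega> p (w p # Xs))"

text \<open>Below, \<open>g\<close> is the matrix \<open>(g\<^sub>i\<^sub>j)\<close> of a metric on \<open>\<real>\<^sup>n\<close>, as a function on \<open>\<real>\<^sup>n \<times> \<real>\<close>;
  \<open>matrix_inv (g p)\<close> is \<open>(g\<^sup>i\<^sup>j)\<close>, and \<open>christoffel g i l m\<close> is \<open>\<Gamma>\<^sup>i\<^sub>l\<^sub>m\<close>.\<close>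

definition christoffel :: "('n::finite pt \<Rightarrow> real^'n^'n) \<Rightarrow> 'n \<Rightarrow> 'n \<Rightarrow> 'n \<Rightarrow> 'n pt \<Rightarrow> real" where
  "christoffel g i l m p = (1/2) * (\<Sum>k\<in>UNIV. matrix_inv (g p) $ i $ k *
     (pdx l (\<lambda>q. g q $ k $ m) p + pdx m (\<lambda>q. g q $ k $ l) p - pdx k (\<lambda>q. g q $ l $ m) p))"

text \<open>\<open>nabla_vec g \<nu> Y\<close> is \<open>\<nabla>\<^sub>\<nu> Y\<close> for a vector field \<open>Y\<close> with constant components;
  \<open>nabla\<close> is the induced Levi-Civita derivative \<open>\<nabla>\<^sub>\<nu>\<close> of forms (Leibniz rule).\<close>

definition nabla_vec :: "('n::finite pt \<Rightarrow> real^'n^'n) \<Rightarrow> 'n \<Rightarrow> real^'n \<Rightarrow> 'n pt \<Rightarrow> real^'n" where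
  "nabla_vec g \<nu> Y p = (\<chi> i. \<Sum>m\<in>UNIV. christoffel g i \<nu> m p * Y $ m)"

definition nabla :: "('n::finite pt \<Rightarrow> real^'n^'n) \<Rightarrow> 'n \<Rightarrow> 'n tform \<Rightarrow> 'n tform" where
  "nabla g \<nu> \<omega> = (\<lambda>p Xs. pdx \<nu> (\<lambda>q. \<omega> q Xs) p
     - (\<Sum>j<length Xs. \<omega> p (Xs[j := nabla_vec g \<nu> (Xs ! j) p])))"

definition delta_diff :: "('n::finite pt \<Rightarrow> real^'n^'n) \<Rightarrow> 'n tform \<Rightarrow> 'n tform" where
  "delta_diff g \<omega> = (\<lambda>p Xs. \<Sum>\<mu>\<in>UNIV. \<Sum>\<nu>\<in>UNIV.
     matrix_inv (g p) $ \<mu> $ \<nu> * interior_prod (\<lambda>_. axis \<mu> 1) (nabla g \<nu> \<omega>) p Xs)"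

definition Delta_diff :: "('n::finite pt \<Rightarrow> real^'n^'n) \<Rightarrow> 'n tform \<Rightarrow> 'n tform" where
  "Delta_diff g \<omega> = delta_diff g (ext_d \<omega>) + ext_d (delta_diff g \<omega>)"

text \<open>\<open>delta_neg v\<close> and \<open>Delta_neg v\<close> are \<open>\<delta>\<close> and \<open>\<Delta>\<close> with index \<open>-v\<close>.\<close>

definition delta_neg :: "('n::finite pt \<Rightarrow> real^'n) \<Rightarrow> 'n tform \<Rightarrow> 'n tform" where
  "delta_neg v \<omega> = - interior_prod v \<omega>"

definition Delta_neg :: "('n::finite pt \<Rightarrow> real^'n) \<Rightarrow> 'n tform \<Rightarrow> 'n tform" where
  "Delta_neg v \<omega> = delta_neg v (ext_d \<omega>) + ext_d (delta_neg v \<omega>)"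

text \<open>Every form on \<open>\<real>\<^sup>n \<times> \<real>\<close> is \<open>\<omega> + \<eta> \<and> dt\<close> with unique \<open>\<omega>\<close>, \<open>\<eta>\<close> without \<open>dt\<close> component. It is
  represented by the pair \<open>(\<omega>, \<eta>)\<close>; zero and addition of forms are those of pairs and functions.\<close>

type_synonym 'n stform = "'n tform \<times> 'n tform"

definition fun_stform :: "('n::finite pt \<Rightarrow> real) \<Rightarrow> 'n stform" where
  "fun_stform f = (fun_form f, 0)"

definition dt_form :: "'n::finite stform" where
  "dt_form = (0, fun_form (\<lambda>_. 1))"

definition scale_form :: "('n::finite pt \<Rightarrow> real) \<Rightarrow> 'n stform \<Rightarrow> 'n stform" (infixr "\<cdot>\<^sub>f" 75) where
  "f \<cdot>\<^sub>f \<Omega> = ((\<lambda>p Xs. f p * fst \<Omega> p Xs), (\<lambda>p Xs. f p * snd \<Omega> p Xs))"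

text \<open>In \<open>d\<^sub>I \<omega> = d\<omega> + (-1)\<^sup>r (\<dots>) \<and> dt\<close> the degree \<open>r\<close> of \<open>\<omega>\<close> equals that of the factor
  \<open>(\<dots>)\<close>, hence the number of its arguments.\<close>

definition d_I :: "('n::finite pt \<Rightarrow> real^'n^'n) \<Rightarrow> ('n pt \<Rightarrow> real^'n) \<Rightarrow> 'n stform \<Rightarrow> 'n stform" where
  "d_I g v \<Omega> = (case \<Omega> of (\<omega>, \<eta>) \<Rightarrow>
     (ext_d \<omega>,
      (\<lambda>p Xs. (-1)^length Xs *
         (pdt (\<lambda>q. \<omega> q Xs) p + (1/2) * Delta_diff g \<omega> p Xs + Delta_neg v \<omega> p Xs)) + ext_d \<eta>))"

text \<open>Agreement with \<open>d\<^sub>I x\<^sup>i = dx\<^sup>i - (v\<^sup>i + 1/2 g\<^sup>l\<^sup>m \<Gamma>\<^sup>i\<^sub>l\<^sub>m) dt\<close>.\<close>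

lemma ddir_const [simp]: "ddir u (\<lambda>_. c) p = 0"
  by (simp add: ddir_def)

lemma ddir_coord [simp]: "ddir u (\<lambda>q. fst q $ i) p = u $ i"
proof -
  have "((\<lambda>x. x $ i) has_derivative (\<lambda>x. x $ i)) (at (fst p))"
    by (rule bounded_linear_imp_has_derivative) (rule bounded_linear_vec_nth)
  then show ?thesis
    by (simp add: ddir_def frechet_derivative_at[symmetric])
qed

lemma pdx_const [simp]: "pdx i (\<lambda>_. c) p = 0"
  by (simp add: pdx_def)

lemma ext_d_coord:
  "ext_d (fun_form (\<lambda>p. fst p $ i)) = (\<lambda>p Xs. if length Xs = 1 then hd Xs $ i else 0)"
proof (intro ext)
  fix p :: "'a pt" and Xs :: "(real^'a) list"
  consider "Xs = []" | X where "Xs = [X]" | X Y Zs where "Xs = X # Y # Zs"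
    by (metis list.exhaust)
  then show "ext_d (fun_form (\<lambda>p. fst p $ i)) p Xs = (if length Xs = 1 then hd Xs $ i else 0)"
  proof cases
    case 3
    have "ddir u (\<lambda>q. fun_form (\<lambda>p. fst p $ i) q (take j Xs @ drop (Suc j) Xs)) p = 0"
      if "j < length Xs" for u j
      using that 3 by (cases j) (simp_all add: fun_form_def)
    then show ?thesis using 3 by (simp add: ext_d_def)
  qed (simp_all add: ext_d_def fun_form_def)
qed

lemma delta_fun_form:
  "delta_diff g (fun_form f) = 0" "delta_neg v (fun_form f) = 0" "ext_d 0 = 0"
  by (simp_all add: fun_eq_iff delta_diff_def interior_prod_def nabla_def fun_form_def
      delta_neg_def ext_d_def)

lemma christoffel_sym:
  assumes "\<And>p. transpose (g p) = g p"
  shows "christoffel g i l m p = christoffel g i m l p"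
proof -
  have "g q $ a $ b = g q $ b $ a" for q a b
    using assms[of q] by (metis transpose_def vec_lambda_beta)
  then have "(\<lambda>q. g q $ l $ m) = (\<lambda>q. g q $ m $ l)" by blast
  then show ?thesis by (simp add: christoffel_def add.commute)
qed

lemma d_I_coord:
  assumes "\<And>p. transpose (g p) = g p"
  shows "d_I g v (fun_stform (\<lambda>p. fst p $ i)) =
     ((\<lambda>p Xs. if length Xs = 1 then hd Xs $ i else 0),
      fun_form (\<lambda>p. - (v p $ i + (1/2) * (\<Sum>l\<in>UNIV. \<Sum>m\<in>UNIV.
         matrix_inv (g p) $ l $ m * christoffel g i l m p))))"
proof -
  let ?x = "fun_form (\<lambda>p. fst p $ i)"
  have t: "pdt (\<lambda>q. ?x q Xs) p = 0" for p Xs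
    by (cases "Xs = []") (simp_all add: pdt_def fun_form_def)
  have D: "Delta_neg v ?x p Xs = (if Xs = [] then - v p $ i else 0)" for p Xs
    unfolding Delta_neg_def delta_fun_form ext_d_coord
    by (simp add: delta_neg_def interior_prod_def)
  have n: "nabla_vec g \<nu> (axis \<mu> 1) p $ i = christoffel g i \<mu> \<nu> p" for \<nu> \<mu> p
    unfolding christoffel_sym[where g = g and l = \<mu>, OF assms]
    by (simp add: nabla_vec_def axis_def if_distrib cong: if_cong)
  have L: "Delta_diff g ?x p Xs = (if Xs = [] then
      - (\<Sum>l\<in>UNIV. \<Sum>m\<in>UNIV. matrix_inv (g p) $ l $ m * christoffel g i l m p) else 0)" for p Xs
    unfolding Delta_diff_def delta_fun_form ext_d_coord
    by (simp add: delta_diff_def interior_prod_def nabla_def n sum_negf)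
  show ?thesis
    unfolding d_I_def fun_stform_def prod.case ext_d_coord delta_fun_form t D L
    by (simp add: fun_eq_iff fun_form_def)
qed

text \<open>The covector components \<open>g\<^sub>k\<^sub>j v\<^sup>j\<close>.\<close>

definition lower :: "('n::finite pt \<Rightarrow> real^'n^'n) \<Rightarrow> ('n pt \<Rightarrow> real^'n) \<Rightarrow> 'n \<Rightarrow> 'n pt \<Rightarrow> real" where
  "lower g v k p = (\<Sum>j\<in>UNIV. g p $ k $ j * v p $ j)"

definition xi_form :: "('n::finite pt \<Rightarrow> real^'n^'n) \<Rightarrow> ('n pt \<Rightarrow> real^'n) \<Rightarrow> 'n stform" where
  "xi_form g v = (\<Sum>i\<in>UNIV. lower g v i \<cdot>\<^sub>f d_I g v (fun_stform (\<lambda>p. fst p $ i)))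
     + (\<lambda>p. (1/2) * (\<Sum>i\<in>UNIV. \<Sum>j\<in>UNIV. g p $ i $ j * v p $ i * v p $ j)) \<cdot>\<^sub>f dt_form"

end

theory Submission
  imports Defs
begin

text \<open>
Write \<open>u\<^sub>k = g\<^sub>k\<^sub>j v\<^sup>j\<close>, \<open>V = u\<^sub>i v\<^sup>i\<close>, \<open>T = g\<^sup>m\<^sup>n \<partial>\<^sub>n u\<^sub>m\<close> and \<open>U = u\<^sub>i g\<^sup>l\<^sup>m \<Gamma>\<^sup>i\<^sub>l\<^sub>m\<close>. By the formula for
\<open>d\<^sub>I x\<^sup>i\<close>, the form \<open>\<xi>\<close> is \<open>\<omega> + f dt\<close> with \<open>\<omega> = u\<^sub>k dx\<^sup>k\<close> and \<open>f = - V/2 - U/2\<close>: the quadratic term of \<open>\<xi>\<close>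
halves the contribution \<open>- V\<close> of the drift (\<open>xi_form_eq\<close>).

The component of \<open>d\<^sub>I \<xi>\<close> without \<open>dt\<close> is \<open>d\<omega>\<close>, which vanishes exactly under the second condition
(\<open>closed_one_form_iff\<close>). Both sides of the equivalence thus imply that \<open>\<omega>\<close> is closed, and for closed \<open>\<omega>\<close>
each Laplacian \<open>\<delta>d + d\<delta>\<close> reduces to \<open>d\<delta>\<close>, the differential of a function:
\<open>\<delta>\<^bsub>diff\<^esub> \<omega> = T - U\<close> and \<open>\<delta>\<^bsub>-v\<^esub> \<omega> = - V\<close>. The \<open>dt\<close> component of \<open>d\<^sub>I \<xi>\<close> then vanishes exactly if
\<open>\<partial>\<^sub>k f = \<partial>\<^sub>t u\<^sub>k + \<partial>\<^sub>k (T - U)/2 - \<partial>\<^sub>k V\<close> for all \<open>k\<close> (\<open>d_I_closed_one_form\<close>). The Christoffel terms \<open>U\<close> cancel,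
and what is left is
\<open>\<partial>\<^sub>k T / 2 = \<partial>\<^sub>k V / 2 - \<partial>\<^sub>t u\<^sub>k\<close>.
Expanding by the product rule, exchanging second derivatives and using \<open>\<partial>\<^sub>i u\<^sub>j = \<partial>\<^sub>j u\<^sub>i\<close> once more turns
this into the first condition (\<open>d_I_xi_form_iff\<close>).

The analytic input is that all functions involved are smooth, in particular the inverse matrix \<open>g\<close> of \<open>a\<close>
(\<open>smooth_matrix_inv\<close>, by Cramer's rule), and that second derivatives commute
(\<open>second_derivative_symmetric\<close>).
\<close>

section \<open>Closure properties of smooth functions\<close>

lemma Ck_SucD: "Ck (Suc k) f \<Longrightarrow> Ck k f"
proof (induction k arbitrary: f)
  case 0
  then show ?case
    by (auto intro!: continuous_at_imp_continuous_on differentiable_imp_continuous_within)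
next
  case (Suc k)
  have "f differentiable (at x)" for x
    using Suc.prems by simp
  moreover have "Ck k (\<lambda>x. frechet_derivative f (at x) u)" for u
    using Suc.prems by (intro Suc.IH) simp
  ultimately show ?case by simp
qed

lemma Ck_const: "Ck k (\<lambda>_. c)"
  by (induction k arbitrary: c) simp_all

lemma Ck_bounded_linear: "bounded_linear L \<Longrightarrow> Ck k f \<Longrightarrow> Ck k (\<lambda>x. L (f x))"
proof (induction k arbitrary: f)
  case 0
  then show ?case by (simp add: bounded_linear.continuous_on)
next
  case (Suc k)
  have der: "((\<lambda>x. L (f x)) has_derivative (\<lambda>u. L (frechet_derivative f (at x) u))) (at x)" for x
    using Suc.prems bounded_linear.has_derivative[of L f "frechet_derivative f (at x)" "at x"]
    by (simp add: frechet_derivative_works)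
  have "Ck k (\<lambda>x. L (frechet_derivative f (at x) u))" for u
    using Suc.prems Suc.IH[of "\<lambda>x. frechet_derivative f (at x) u"] by simp
  with der show ?case
    unfolding Ck.simps frechet_derivative_at[OF der, symmetric] differentiable_def by blast
qed

lemma Ck_add: "Ck k f \<Longrightarrow> Ck k g \<Longrightarrow> Ck k (\<lambda>x. f x + g x)"
proof (induction k arbitrary: f g)
  case 0
  then show ?case by (simp add: continuous_on_add)
next
  case (Suc k)
  have der: "((\<lambda>x. f x + g x) has_derivative
      (\<lambda>u. frechet_derivative f (at x) u + frechet_derivative g (at x) u)) (at x)" for x
    using Suc.prems by (intro has_derivative_add) (auto simp: frechet_derivative_works)
  have "Ck k (\<lambda>x. frechet_derivative f (at x) u + frechet_derivative g (at x) u)" for u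
    using Suc.prems by (intro Suc.IH[of "\<lambda>x. frechet_derivative f (at x) u"
          "\<lambda>x. frechet_derivative g (at x) u"]) auto
  with der show ?case
    unfolding Ck.simps frechet_derivative_at[OF der, symmetric] differentiable_def by blast
qed

text \<open>The derivative of a product contains the undifferentiated factors, so the induction hypothesis needs
  these at the lower order as well; \<open>Ck_SucD\<close> supplies that.\<close>

lemma Ck_mult:
  fixes f g :: "'a::euclidean_space \<Rightarrow> real"
  shows "Ck k f \<Longrightarrow> Ck k g \<Longrightarrow> Ck k (\<lambda>x. f x * g x)"
proof (induction k arbitrary: f g)
  case 0
  then show ?case by (simp add: continuous_on_mult)
next
  case (Suc k)
  have der: "((\<lambda>x. f x * g x) has_derivative
      (\<lambda>u. f x * frechet_derivative g (at x) u + frechet_derivative f (at x) u * g x)) (at x)" for x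
    using Suc.prems by (intro has_derivative_mult) (auto simp: frechet_derivative_works)
  have "Ck k (\<lambda>x. f x * frechet_derivative g (at x) u + frechet_derivative f (at x) u * g x)" for u
    using Suc.prems Ck_SucD[OF Suc.prems(1)] Ck_SucD[OF Suc.prems(2)]
    by (intro Ck_add Suc.IH) auto
  with der show ?case
    unfolding Ck.simps frechet_derivative_at[OF der, symmetric] differentiable_def by blast
qed

lemma Ck_inverse:
  fixes f :: "'a::euclidean_space \<Rightarrow> real"
  assumes "\<And>x. f x \<noteq> 0"
  shows "Ck k f \<Longrightarrow> Ck k (\<lambda>x. inverse (f x))"
proof (induction k)
  case 0
  then show ?case using assms by (simp add: continuous_on_inverse)
next
  case (Suc k)
  have der: "((\<lambda>x. inverse (f x)) has_derivative
      (\<lambda>u. (- 1) * (inverse (f x) * frechet_derivative f (at x) u * inverse (f x)))) (at x)" for x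
    using Deriv.has_derivative_inverse[of f x "frechet_derivative f (at x)" UNIV] Suc.prems assms
    by (simp add: frechet_derivative_works)
  have "Ck k (\<lambda>x. (- 1) * (inverse (f x) * frechet_derivative f (at x) u * inverse (f x)))" for u
    using Suc.prems Suc.IH[OF Ck_SucD[OF Suc.prems]]
    by (intro Ck_mult Ck_const) auto
  with der show ?case
    unfolding Ck.simps frechet_derivative_at[OF der, symmetric] differentiable_def by blast
qed

lemma smooth_const: "smooth (\<lambda>_. c)"
  by (simp add: smooth_def Ck_const)

lemma smooth_bounded_linear: "bounded_linear L \<Longrightarrow> smooth f \<Longrightarrow> smooth (\<lambda>x. L (f x))"
  using Ck_bounded_linear[where L = L and f = f] unfolding smooth_def by blast

lemma smooth_add: "smooth f \<Longrightarrow> smooth g \<Longrightarrow> smooth (\<lambda>x. f x + g x)"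
  using Ck_add[where f = f and g = g] unfolding smooth_def by blast

lemma smooth_mult:
  fixes f g :: "'a::euclidean_space \<Rightarrow> real"
  shows "smooth f \<Longrightarrow> smooth g \<Longrightarrow> smooth (\<lambda>x. f x * g x)"
  using Ck_mult[where f = f and g = g] unfolding smooth_def by blast

lemma smooth_diff:
  fixes f g :: "'a::euclidean_space \<Rightarrow> real"
  assumes "smooth f" "smooth g"
  shows "smooth (\<lambda>x. f x - g x)"
  using smooth_add[OF assms(1) smooth_mult[OF smooth_const[of "-1"] assms(2)]] by simp

lemma smooth_divide:
  fixes f g :: "'a::euclidean_space \<Rightarrow> real"
  assumes "smooth f" "smooth g" "\<And>x. g x \<noteq> 0"
  shows "smooth (\<lambda>x. f x / g x)"
proof -
  have "smooth (\<lambda>x. inverse (g x))"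
    using Ck_inverse[where f = g] assms unfolding smooth_def by blast
  from smooth_mult[OF assms(1) this] show ?thesis
    by (simp add: divide_inverse)
qed

lemma smooth_sum:
  "(\<And>i. i \<in> I \<Longrightarrow> smooth (f i)) \<Longrightarrow> smooth (\<lambda>x. \<Sum>i\<in>I. f i x)"
  by (induction I rule: infinite_finite_induct) (auto intro: smooth_add smooth_const)

lemma smooth_prod:
  fixes f :: "'i \<Rightarrow> 'a::euclidean_space \<Rightarrow> real"
  shows "(\<And>i. i \<in> I \<Longrightarrow> smooth (f i)) \<Longrightarrow> smooth (\<lambda>x. \<Prod>i\<in>I. f i x)"
  by (induction I rule: infinite_finite_induct) (auto intro: smooth_mult smooth_const)

lemmas smooth_intros =
  smooth_const smooth_add smooth_mult smooth_diff smooth_divide smooth_sum smooth_prod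

lemma smooth_vec_nth: "smooth f \<Longrightarrow> smooth (\<lambda>x. f x $ i)"
  by (rule smooth_bounded_linear[OF bounded_linear_vec_nth])

lemma smooth_frechet: "smooth f \<Longrightarrow> smooth (\<lambda>x. frechet_derivative f (at x) u)"
  unfolding smooth_def by (metis Ck.simps(2))

lemma smooth_has_derivative:
  "smooth f \<Longrightarrow> (f has_derivative frechet_derivative f (at x)) (at x)"
  unfolding smooth_def frechet_derivative_works[symmetric] by (metis Ck.simps(2))

lemma smooth_isCont: "smooth f \<Longrightarrow> isCont f x"
  unfolding smooth_def
  by (metis Ck.simps(1) continuous_on_eq_continuous_at open_UNIV UNIV_I)

section \<open>Smoothness of the inverse matrix\<close>

lemma smooth_det:
  fixes A :: "'a::euclidean_space \<Rightarrow> real^'n^'n"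
  assumes "\<And>i j. smooth (\<lambda>x. A x $ i $ j)"
  shows "smooth (\<lambda>x. det (A x))"
  unfolding det_def by (intro smooth_intros assms)

lemma matrix_inv_inverse:
  fixes A :: "real^'n^'n"
  assumes "invertible A"
  shows "A ** matrix_inv A = mat 1" "matrix_inv A ** A = mat 1"
  using someI_ex[OF assms[unfolded invertible_def]] by (simp_all add: matrix_inv_def)

lemma matrix_inv_unique:
  fixes A B :: "real^'n^'n"
  assumes "A ** B = mat 1"
  shows "matrix_inv A = B"
proof -
  have "invertible A"
    using assms matrix_left_right_inverse[of A B] by (auto simp: invertible_def)
  have "matrix_inv A = matrix_inv A ** (A ** B)"
    by (simp add: assms)
  also have "\<dots> = B"
    by (simp add: matrix_mul_assoc matrix_inv_inverse[OF \<open>invertible A\<close>])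
  finally show ?thesis .
qed

text \<open>Cramer's rule for the columns of the inverse exhibits each entry as a quotient of polynomials in
  the entries of \<open>A\<close>; this is what makes the inverse smooth.\<close>

lemma matrix_inv_cramer:
  fixes A :: "real^'n^'n"
  assumes "invertible A"
  shows "matrix_inv A $ k $ l =
    det (\<chi> i j. if j = k then axis l 1 $ i else A $ i $ j) / det A"
proof -
  have "A *v (matrix_inv A *v axis l 1) = axis l 1"
    using assms by (simp add: matrix_vector_mul_assoc matrix_inv_inverse)
  moreover have "det A \<noteq> 0"
    using assms by (simp add: invertible_det_nz)
  ultimately have "matrix_inv A *v axis l 1 =
      (\<chi> k. det (\<chi> i j. if j = k then axis l 1 $ i else A $ i $ j) / det A)"
    by (simp add: cramer)
  moreover have "(matrix_inv A *v axis l 1) $ k = matrix_inv A $ k $ l"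
    by (simp add: matrix_vector_mult_def axis_def if_distrib cong: if_cong)
  ultimately show ?thesis by simp
qed

lemma smooth_matrix_inv:
  fixes A :: "'a::euclidean_space \<Rightarrow> real^'n^'n"
  assumes "\<And>i j. smooth (\<lambda>x. A x $ i $ j)" "\<And>x. invertible (A x)"
  shows "smooth (\<lambda>x. matrix_inv (A x) $ k $ l)"
proof -
  have "smooth (\<lambda>x. det (\<chi> i j. if j = k then axis l 1 $ i else A x $ i $ j))"
  proof (rule smooth_det)
    show "smooth (\<lambda>x. (\<chi> i j. if j = k then axis l 1 $ i else A x $ i $ j) $ i $ j)" for i j
      by (cases "j = k") (simp_all add: smooth_const assms(1))
  qed
  then show ?thesis
    unfolding matrix_inv_cramer[OF assms(2)]
    using assms by (intro smooth_divide smooth_det[of A]) (simp_all flip: invertible_det_nz)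
qed

section \<open>Symmetry of second derivatives\<close>

text \<open>The mean value theorem applies first to \<open>r \<mapsto> f (p + h w + r u) - f (p + r u)\<close>, a difference of two
  values on parallel lines, and then to the resulting difference of the derivatives along \<open>u\<close>.\<close>

lemma second_difference_mvt:
  fixes f :: "'a::euclidean_space \<Rightarrow> real"
  assumes f: "smooth f" and "h > 0"
  shows "\<exists>r s. 0 < r \<and> r < h \<and> 0 < s \<and> s < h \<and>
     f (p + h *\<^sub>R u + h *\<^sub>R w) - f (p + h *\<^sub>R u) - f (p + h *\<^sub>R w) + f p =
     h * h * frechet_derivative (\<lambda>x. frechet_derivative f (at x) u) (at (p + r *\<^sub>R u + s *\<^sub>R w)) w"
proof -
  have along: "DERIV (\<lambda>s. F (q + s *\<^sub>R z)) s :> frechet_derivative F (at (q + s *\<^sub>R z)) z"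
    if "smooth F" for F :: "'a \<Rightarrow> real" and q z s
  proof -
    have "((\<lambda>s. F (q + s *\<^sub>R z)) has_derivative
        (\<lambda>r. frechet_derivative F (at (q + s *\<^sub>R z)) (r *\<^sub>R z))) (at s)"
      by (rule has_derivative_compose[OF _ smooth_has_derivative[OF that]])
        (auto intro!: derivative_eq_intros)
    moreover have "frechet_derivative F (at (q + s *\<^sub>R z)) (r *\<^sub>R z) =
        frechet_derivative F (at (q + s *\<^sub>R z)) z * r" for r
      using linear_scale[OF has_derivative_linear[OF smooth_has_derivative[OF that]]]
      by simp
    ultimately show ?thesis
      by (simp add: has_field_derivative_def)
  qed
  let ?D = "\<lambda>x. frechet_derivative f (at x) u"
  have "DERIV (\<lambda>s. f ((p + h *\<^sub>R w) + s *\<^sub>R u) - f (p + s *\<^sub>R u)) s :>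
      ?D ((p + h *\<^sub>R w) + s *\<^sub>R u) - ?D (p + s *\<^sub>R u)" for s
    by (intro DERIV_diff along f)
  from MVT2[OF \<open>h > 0\<close> this] obtain r where r: "0 < r" "r < h"
    "f ((p + h *\<^sub>R w) + h *\<^sub>R u) - f (p + h *\<^sub>R u) - (f (p + h *\<^sub>R w) - f p) =
      h * (?D ((p + h *\<^sub>R w) + r *\<^sub>R u) - ?D (p + r *\<^sub>R u))"
    by auto
  have "DERIV (\<lambda>s. ?D ((p + r *\<^sub>R u) + s *\<^sub>R w)) s :>
      frechet_derivative ?D (at (p + r *\<^sub>R u + s *\<^sub>R w)) w" for s
    by (intro along smooth_frechet f)
  from MVT2[OF \<open>h > 0\<close> this]
  obtain s where s: "0 < s" "s < h"
    "?D ((p + r *\<^sub>R u) + h *\<^sub>R w) - ?D (p + r *\<^sub>R u) =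
      h * frechet_derivative ?D (at (p + r *\<^sub>R u + s *\<^sub>R w)) w"
    by auto
  have eq: "(p + h *\<^sub>R w) + h *\<^sub>R u = p + h *\<^sub>R u + h *\<^sub>R w"
    "(p + h *\<^sub>R w) + r *\<^sub>R u = (p + r *\<^sub>R u) + h *\<^sub>R w"
    by (simp_all add: algebra_simps)
  show ?thesis
    using r s unfolding eq by (intro exI[of _ r] exI[of _ s]) (simp add: algebra_simps)
qed

text \<open>The second difference is symmetric in \<open>u\<close> and \<open>w\<close>. By the previous lemma it equals \<open>h\<^sup>2\<close> times either
  mixed derivative, each at some point of the parallelogram of size \<open>h\<close> at \<open>p\<close>; both derivatives are
  continuous, so their values at \<open>p\<close> cannot differ.\<close>

lemma second_derivative_symmetric:
  fixes f :: "'a::euclidean_space \<Rightarrow> real"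
  assumes f: "smooth f"
  shows "frechet_derivative (\<lambda>x. frechet_derivative f (at x) u) (at p) w =
         frechet_derivative (\<lambda>x. frechet_derivative f (at x) w) (at p) u"
proof (rule ccontr)
  define A where "A = (\<lambda>x. frechet_derivative (\<lambda>x. frechet_derivative f (at x) u) (at x) w)"
  define B where "B = (\<lambda>x. frechet_derivative (\<lambda>x. frechet_derivative f (at x) w) (at x) u)"
  assume "\<not> ?thesis"
  then have e: "\<bar>A p - B p\<bar> / 2 > 0" by (simp add: A_def B_def)
  have "isCont A p" "isCont B p"
    unfolding A_def B_def by (intro smooth_isCont smooth_frechet f)+
  then obtain d d' where d: "d > 0" "\<And>x. dist x p < d \<Longrightarrow> dist (A x) (A p) < \<bar>A p - B p\<bar> / 2"
    and d': "d' > 0" "\<And>x. dist x p < d' \<Longrightarrow> dist (B x) (B p) < \<bar>A p - B p\<bar> / 2"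
    using e unfolding continuous_at_eps_delta by metis
  \<comment> \<open>The whole parallelogram lies within \<open>h (norm u + norm w) < min d d'\<close> of \<open>p\<close>; the summand \<open>1\<close> keeps
    the denominator positive when \<open>u\<close> and \<open>w\<close> vanish.\<close>
  define h where "h = min d d' / (norm u + norm w + 1)"
  have N: "norm u + norm w + 1 > 0"
    using norm_ge_zero[of u] norm_ge_zero[of w] by linarith
  then have h: "h > 0" using d(1) d'(1) by (simp add: h_def)
  have near: "dist (p + r *\<^sub>R u + s *\<^sub>R w) p < min d d'" if "0 < r" "r < h" "0 < s" "s < h" for r s
  proof -
    have "dist (p + r *\<^sub>R u + s *\<^sub>R w) p = norm (r *\<^sub>R u + s *\<^sub>R w)"
      by (simp add: dist_norm algebra_simps)
    also have "\<dots> \<le> r * norm u + s * norm w"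
      using that norm_triangle_ineq[of "r *\<^sub>R u" "s *\<^sub>R w"] by simp
    also have "\<dots> \<le> h * norm u + h * norm w"
      using that by (intro add_mono mult_right_mono) auto
    also have "\<dots> < h * (norm u + norm w + 1)"
      using h by (simp add: algebra_simps)
    also have "\<dots> = min d d'" using N by (simp add: h_def)
    finally show ?thesis .
  qed
  have A: "frechet_derivative (\<lambda>x. frechet_derivative f (at x) u) (at x) w = A x" for x
    by (simp add: A_def)
  have B: "frechet_derivative (\<lambda>x. frechet_derivative f (at x) w) (at x) u = B x" for x
    by (simp add: B_def)
  obtain r s where rs: "0 < r" "r < h" "0 < s" "s < h"
    "f (p + h *\<^sub>R u + h *\<^sub>R w) - f (p + h *\<^sub>R u) - f (p + h *\<^sub>R w) + f p =
      h * h * A (p + r *\<^sub>R u + s *\<^sub>R w)"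
    using second_difference_mvt[OF f h, of p u w, unfolded A] by (elim exE conjE)
  obtain r' s' where rs': "0 < r'" "r' < h" "0 < s'" "s' < h"
    "f (p + h *\<^sub>R w + h *\<^sub>R u) - f (p + h *\<^sub>R w) - f (p + h *\<^sub>R u) + f p =
      h * h * B (p + r' *\<^sub>R w + s' *\<^sub>R u)"
    using second_difference_mvt[OF f h, of p w u, unfolded B] by (elim exE conjE)
  have swap: "p + x + y = p + y + x" for x y :: 'a
    by simp
  have "h * h * A (p + r *\<^sub>R u + s *\<^sub>R w) = h * h * B (p + r' *\<^sub>R w + s' *\<^sub>R u)"
    using rs(5) rs'(5)[unfolded swap[of "h *\<^sub>R w" "h *\<^sub>R u"]] by linarith
  then have "A (p + r *\<^sub>R u + s *\<^sub>R w) = B (p + s' *\<^sub>R u + r' *\<^sub>R w)"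
    using h swap[of "r' *\<^sub>R w" "s' *\<^sub>R u"] by simp
  moreover have "dist (A (p + r *\<^sub>R u + s *\<^sub>R w)) (A p) < \<bar>A p - B p\<bar> / 2"
    using near[OF rs(1-4)] by (intro d(2)) simp
  moreover have "dist (B (p + s' *\<^sub>R u + r' *\<^sub>R w)) (B p) < \<bar>A p - B p\<bar> / 2"
    using near[OF rs'(3,4,1,2)] by (intro d'(2)) simp
  ultimately show False
    by (simp add: dist_real_def abs_if split: if_splits)
qed

section \<open>Partial derivatives\<close>

text \<open>Differentiating at fixed \<open>t\<close> is differentiating on \<open>\<real>\<^sup>n \<times> \<real>\<close> in the direction \<open>(X, 0)\<close>. This turns
  \<open>ddir\<close> into a derivative to which the smoothness hypotheses, posed on \<open>\<real>\<^sup>n \<times> \<real>\<close>, apply.\<close>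

lemma ddir_eqI:
  assumes "(f has_derivative f') (at p)"
  shows "ddir X f p = f' (X, 0)"
proof -
  have "((\<lambda>x. f (x, snd p)) has_derivative (\<lambda>X. f' (X, 0))) (at (fst p))"
    using has_derivative_compose[OF has_derivative_Pair[OF has_derivative_ident
          has_derivative_const[where c = "snd p"]], of f f' "fst p" UNIV] assms
    by simp
  then show ?thesis
    unfolding ddir_def using frechet_derivative_at by metis
qed

lemma ddir_frechet: "smooth f \<Longrightarrow> ddir X f p = frechet_derivative f (at p) (X, 0)"
  by (rule ddir_eqI[OF smooth_has_derivative])

lemma ddir_smooth_eq: "smooth f \<Longrightarrow> ddir X f = (\<lambda>p. frechet_derivative f (at p) (X, 0))"
  by (simp add: fun_eq_iff ddir_frechet)

lemma smooth_ddir: "smooth f \<Longrightarrow> smooth (ddir X f)"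
  by (simp add: ddir_smooth_eq smooth_frechet)

lemma smooth_pdx: "smooth f \<Longrightarrow> smooth (pdx i f)"
  by (simp add: pdx_def smooth_ddir)

lemma ddir_commute: "smooth f \<Longrightarrow> ddir X (ddir Y f) p = ddir Y (ddir X f) p"
  using second_derivative_symmetric[of f "(Y, 0)" p "(X, 0)"]
  by (simp add: ddir_smooth_eq smooth_frechet)

lemma pdx_commute: "smooth f \<Longrightarrow> pdx i (pdx j f) p = pdx j (pdx i f) p"
  by (simp add: pdx_def ddir_commute)

lemma ddir_add:
  assumes "smooth f" "smooth g"
  shows "ddir X (\<lambda>q. f q + g q) p = ddir X f p + ddir X g p"
  using ddir_eqI[OF has_derivative_add[OF assms[THEN smooth_has_derivative]]] assms
  by (simp add: ddir_frechet)

lemma ddir_mult: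
  assumes "smooth f" "smooth g"
  shows "ddir X (\<lambda>q. f q * g q) p = f p * ddir X g p + ddir X f p * g p"
  using ddir_eqI[OF has_derivative_mult[OF assms[THEN smooth_has_derivative]]] assms
  by (simp add: ddir_frechet)

lemma ddir_cmult: "smooth f \<Longrightarrow> ddir X (\<lambda>q. c * f q) p = c * ddir X f p"
  using ddir_mult[OF smooth_const[of c]] by simp

lemma ddir_diff:
  assumes "smooth f" "smooth g"
  shows "ddir X (\<lambda>q. f q - g q) p = ddir X f p - ddir X g p"
  using ddir_add[OF assms(1) smooth_mult[OF smooth_const[of "-1"] assms(2)]]
    ddir_cmult[OF assms(2), of X "-1"] by simp

lemma ddir_sum:
  assumes "\<And>i. i \<in> I \<Longrightarrow> smooth (f i)"
  shows "ddir X (\<lambda>q. \<Sum>i\<in>I. f i q) p = (\<Sum>i\<in>I. ddir X (f i) p)"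
  using assms
  by (induction I rule: infinite_finite_induct) (simp_all add: ddir_add smooth_sum)

lemma ddir_expand:
  assumes "smooth f"
  shows "ddir X f p = (\<Sum>k\<in>UNIV. X $ k * pdx k f p)"
proof -
  have "linear (\<lambda>X. frechet_derivative f (at p) (X, 0))"
    using linear_compose[OF _ has_derivative_linear[OF smooth_has_derivative[OF assms]],
        of "\<lambda>X. (X, 0)"] by (simp add: linear_iff comp_def)
  then have "linear (\<lambda>X. ddir X f p)"
    by (simp add: ddir_frechet assms)
  from linear_sum[OF this, of "\<lambda>k. X $ k *\<^sub>R axis k 1" UNIV] linear_scale[OF this]
  have "ddir (\<Sum>k\<in>UNIV. X $ k *\<^sub>R axis k 1) f p = (\<Sum>k\<in>UNIV. X $ k * ddir (axis k 1) f p)"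
    by simp
  then show ?thesis
    by (simp add: pdx_def basis_expansion flip: scalar_mult_eq_scaleR)
qed

lemma smooth_DERIV_time:
  assumes "smooth f"
  shows "DERIV (\<lambda>s. f (x, s)) t :> pdt f (x, t)"
proof -
  have "((\<lambda>s. f (x, s)) has_derivative (\<lambda>s. frechet_derivative f (at (x, t)) (0, s))) (at t)"
    using has_derivative_compose[OF has_derivative_Pair[OF
          has_derivative_const[where c = x] has_derivative_ident], of f _ t UNIV]
      smooth_has_derivative[OF assms, of "(x, t)"]
    by simp
  then have "(\<lambda>s. f (x, s)) differentiable (at t)"
    by (auto simp: differentiable_def)
  then show ?thesis
    by (simp add: pdt_def DERIV_deriv_iff_real_differentiable)
qed

lemma pdt_linear_combination:
  assumes "\<And>k. smooth (u k)"
  shows "pdt (\<lambda>q. \<Sum>k\<in>UNIV. u k q * X $ k) p = (\<Sum>k\<in>UNIV. X $ k * pdt (u k) p)"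
proof -
  have "DERIV (\<lambda>s. \<Sum>k\<in>UNIV. u k (fst p, s) * X $ k) (snd p) :> (\<Sum>k\<in>UNIV. pdt (u k) p * X $ k)"
    using smooth_DERIV_time[OF assms, of _ "fst p" "snd p"]
    by (intro DERIV_sum DERIV_cmult_right) simp
  then show ?thesis
    unfolding pdt_def[of "\<lambda>q. \<Sum>k\<in>UNIV. u k q * X $ k"]
    by (simp add: DERIV_imp_deriv mult.commute)
qed


section \<open>Forms of degree one\<close>

definition one_form :: "('n \<Rightarrow> 'n::finite pt \<Rightarrow> real) \<Rightarrow> 'n tform" where
  "one_form u = (\<lambda>p Xs. if length Xs = 1 then \<Sum>k\<in>UNIV. u k p * hd Xs $ k else 0)"

text \<open>The covariant divergence \<open>g\<^sup>\<mu>\<^sup>\<nu> (\<nabla>\<^sub>\<nu> u)\<^sub>\<mu>\<close> of the covector field \<open>u\<close>.\<close>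

definition codiff :: "('n::finite pt \<Rightarrow> real^'n^'n) \<Rightarrow> ('n \<Rightarrow> 'n pt \<Rightarrow> real) \<Rightarrow> 'n pt \<Rightarrow> real" where
  "codiff g u p = (\<Sum>\<mu>\<in>UNIV. \<Sum>\<nu>\<in>UNIV. matrix_inv (g p) $ \<mu> $ \<nu> *
     (pdx \<nu> (u \<mu>) p - (\<Sum>i\<in>UNIV. u i p * christoffel g i \<nu> \<mu> p)))"

lemma sum_fun_apply: "(\<Sum>i\<in>I. f i) x = (\<Sum>i\<in>I. f i x)"
  by (induction I rule: infinite_finite_induct) simp_all

lemma sum_axis: "(\<Sum>k\<in>UNIV. f k * (axis i 1 :: real^'n) $ k) = f i"
  by (simp add: axis_def if_distrib cong: if_cong)

lemma one_form_single [simp]: "one_form u p [X] = (\<Sum>k\<in>UNIV. u k p * X $ k)"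
  by (simp add: one_form_def)

lemma one_form_other: "length Xs \<noteq> 1 \<Longrightarrow> one_form u p Xs = 0"
  by (simp add: one_form_def)

lemma ext_d_fun_form:
  "ext_d (fun_form f) = (\<lambda>p Xs. if length Xs = 1 then ddir (hd Xs) f p else 0)"
proof (intro ext)
  fix p :: "'a pt" and Xs :: "(real^'a) list"
  consider "Xs = []" | X where "Xs = [X]" | "length Xs \<ge> 2"
    by (metis One_nat_def Suc_1 Suc_leI length_0_conv length_Suc_conv less_2_cases_iff linorder_not_less)
  then show "ext_d (fun_form f) p Xs = (if length Xs = 1 then ddir (hd Xs) f p else 0)"
  proof cases
    case 3
    have "ddir (Xs ! j) (\<lambda>q. fun_form f q (take j Xs @ drop (Suc j) Xs)) p = 0"
      if "j < length Xs" for j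
    proof -
      have "take j Xs @ drop (Suc j) Xs \<noteq> []"
        using that 3 by (cases j) auto
      then show ?thesis
        by (simp add: fun_form_def del: append_is_Nil_conv)
    qed
    then show ?thesis using 3 by (simp add: ext_d_def)
  qed (simp_all add: ext_d_def fun_form_def)
qed

lemma ext_d_one_form_pair:
  "ext_d (one_form u) p [X, Y] =
     ddir X (\<lambda>q. \<Sum>k\<in>UNIV. u k q * Y $ k) p - ddir Y (\<lambda>q. \<Sum>k\<in>UNIV. u k q * X $ k) p"
  by (simp add: ext_d_def)

lemma ext_d_one_form_other:
  assumes "length Xs \<noteq> 2"
  shows "ext_d (one_form u) p Xs = 0"
proof -
  have "length (take j Xs @ drop (Suc j) Xs) \<noteq> 1" if "j < length Xs" for j
    using that assms by simp
  then show ?thesis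
    by (simp add: ext_d_def one_form_other)
qed

text \<open>The second condition is the value of \<open>d\<omega>\<close> on pairs of basis vectors. Conversely, expanding
  \<open>d\<omega>(X, Y)\<close> in components gives \<open>X\<^sup>l Y\<^sup>k (\<partial>\<^sub>l u\<^sub>k - \<partial>\<^sub>k u\<^sub>l)\<close>.\<close>

lemma closed_one_form_iff:
  assumes u: "\<And>k. smooth (u k)"
  shows "ext_d (one_form u) = 0 \<longleftrightarrow> (\<forall>p i l. 0 = pdx l (u i) p - pdx i (u l) p)"
proof
  assume closed: "ext_d (one_form u) = 0"
  show "\<forall>p i l. 0 = pdx l (u i) p - pdx i (u l) p"
  proof (intro allI)
    fix p i l
    have "ext_d (one_form u) p [axis l 1, axis i 1] = 0"
      using closed by simp
    then show "0 = pdx l (u i) p - pdx i (u l) p"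
      by (simp add: ext_d_one_form_pair sum_axis pdx_def)
  qed
next
  assume curl: "\<forall>p i l. 0 = pdx l (u i) p - pdx i (u l) p"
  have *: "ddir X (\<lambda>q. \<Sum>k\<in>UNIV. u k q * Y $ k) p =
      (\<Sum>k\<in>UNIV. \<Sum>l\<in>UNIV. X $ l * Y $ k * pdx l (u k) p)" for X Y p
  proof -
    have "ddir X (\<lambda>q. \<Sum>k\<in>UNIV. u k q * Y $ k) p = (\<Sum>k\<in>UNIV. Y $ k * ddir X (u k) p)"
      using u by (subst ddir_sum) (auto simp: ddir_mult smooth_const mult.commute intro: smooth_intros)
    also have "\<dots> = (\<Sum>k\<in>UNIV. \<Sum>l\<in>UNIV. X $ l * Y $ k * pdx l (u k) p)"
      by (simp add: ddir_expand[OF u] sum_distrib_left mult_ac)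
    finally show ?thesis .
  qed
  have "ext_d (one_form u) p [X, Y] = 0" for p X Y
  proof -
    have "(\<Sum>k\<in>UNIV. \<Sum>l\<in>UNIV. X $ l * Y $ k * pdx l (u k) p) =
        (\<Sum>k\<in>UNIV. \<Sum>l\<in>UNIV. Y $ l * X $ k * pdx l (u k) p)"
    proof -
      have "(\<Sum>k\<in>UNIV. \<Sum>l\<in>UNIV. X $ l * Y $ k * pdx l (u k) p) =
          (\<Sum>k\<in>UNIV. \<Sum>l\<in>UNIV. Y $ k * X $ l * pdx k (u l) p)"
      proof (intro sum.cong refl)
        fix k l
        have "pdx l (u k) p = pdx k (u l) p"
          using curl[THEN spec[of _ p], THEN spec[of _ k], THEN spec[of _ l]] by simp
        then show "X $ l * Y $ k * pdx l (u k) p = Y $ k * X $ l * pdx k (u l) p"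
          by simp
      qed
      also have "\<dots> = (\<Sum>k\<in>UNIV. \<Sum>l\<in>UNIV. Y $ l * X $ k * pdx l (u k) p)"
        by (rule sum.swap)
      finally show ?thesis .
    qed
    then show ?thesis
      by (simp add: ext_d_one_form_pair *)
  qed
  then have "ext_d (one_form u) p Xs = 0" for p Xs
  proof (cases "length Xs = 2")
    case True
    then obtain X Y where "Xs = [X, Y]"
      by (auto simp: numeral_2_eq_2 length_Suc_conv)
    then show ?thesis using \<open>\<And>p X Y. ext_d (one_form u) p [X, Y] = 0\<close> by simp
  qed (simp add: ext_d_one_form_other)
  then show "ext_d (one_form u) = 0"
    by (simp add: fun_eq_iff)
qed

lemma delta_diff_one_form: "delta_diff g (one_form u) = fun_form (codiff g u)"
proof (intro ext)
  fix p :: "'a pt" and Xs :: "(real^'a) list"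
  have vec: "nabla_vec g \<nu> (axis \<mu> 1) p $ i = christoffel g i \<nu> \<mu> p" for \<nu> \<mu> i
    by (simp add: nabla_vec_def sum_axis)
  \<comment> \<open>With further arguments \<open>Xs\<close> present, every list fed to the 1-form has length at least two.\<close>
  have other: "one_form u q ((Y # Xs)[j := Z]) = 0" if "Xs \<noteq> []" for q Y Z j
    using that by (intro one_form_other) (simp del: list_update.simps)
  have "nabla g \<nu> (one_form u) p (axis \<mu> 1 # Xs) = (if Xs = [] then
      pdx \<nu> (u \<mu>) p - (\<Sum>i\<in>UNIV. u i p * christoffel g i \<nu> \<mu> p) else 0)" for \<mu> \<nu>
  proof (cases "Xs = []")
    case True
    then show ?thesis by (simp add: nabla_def sum_axis vec)
  next
    case False
    then show ?thesis
      by (simp add: nabla_def one_form_other other del: list_update.simps sum.lessThan_Suc)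
  qed
  then show "delta_diff g (one_form u) p Xs = fun_form (codiff g u) p Xs"
    by (simp add: delta_diff_def interior_prod_def fun_form_def codiff_def)
qed

lemma delta_neg_one_form:
  "delta_neg v (one_form u) = fun_form (\<lambda>p. - (\<Sum>i\<in>UNIV. u i p * v p $ i))"
proof (intro ext)
  fix p :: "'a pt" and Xs :: "(real^'a) list"
  show "delta_neg v (one_form u) p Xs = fun_form (\<lambda>p. - (\<Sum>i\<in>UNIV. u i p * v p $ i)) p Xs"
    by (cases "Xs = []") (simp_all add: delta_neg_def interior_prod_def fun_form_def one_form_other)
qed

lemma delta_zero: "delta_diff g 0 = 0" "delta_neg v 0 = 0"
  by (simp_all add: fun_eq_iff delta_diff_def interior_prod_def nabla_def delta_neg_def)

text \<open>Closedness removes the summand \<open>\<delta>d\<close> from both Laplacians, and \<open>d\<delta>\<close> is the gradient of a function. On 1-forms the sign \<open>(-1)\<^sup>r\<close> is \<open>-1\<close>, hence the vanishing of the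
  \<open>dt\<close> component equates \<open>df\<close> with the bracket in the definition of \<open>d\<^sub>I\<close>.\<close>

lemma d_I_closed_one_form:
  fixes u :: "'n \<Rightarrow> 'n::finite pt \<Rightarrow> real"
  assumes closed: "ext_d (one_form u) = 0"
    and u: "\<And>k. smooth (u k)" and f: "smooth f" and v: "\<And>i. smooth (\<lambda>p. v p $ i)"
    and c: "smooth (codiff g u)"
  shows "d_I g v (one_form u, fun_form f) = 0 \<longleftrightarrow>
    (\<forall>p k. pdx k f p = pdt (u k) p + (1/2) * pdx k (codiff g u) p
       - pdx k (\<lambda>p. \<Sum>i\<in>UNIV. u i p * v p $ i) p)"
    (is "_ \<longleftrightarrow> (\<forall>p k. ?E p k)")
proof -
  let ?V = "\<lambda>p. \<Sum>i\<in>UNIV. u i p * v p $ i"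
  have V: "smooth ?V" by (intro smooth_intros u v)
  have neg: "ddir X (\<lambda>p. - ?V p) p = - ddir X ?V p" for X p
    using ddir_cmult[OF V, of X "-1" p] by simp
  let ?D = "\<lambda>p X. ddir X f p - (pdt (\<lambda>q. \<Sum>k\<in>UNIV. u k q * X $ k) p
     + (1/2) * ddir X (codiff g u) p - ddir X ?V p)"
  have d: "d_I g v (one_form u, fun_form f) =
      (0, \<lambda>p Xs. if length Xs = 1 then ?D p (hd Xs) else 0)"
  proof -
    have "pdt (\<lambda>q. one_form u q Xs) p =
        (if length Xs = 1 then pdt (\<lambda>q. \<Sum>k\<in>UNIV. u k q * hd Xs $ k) p else 0)" for p Xs
      by (simp add: one_form_def pdt_def)
    then show ?thesis
      by (simp add: d_I_def closed Delta_diff_def Delta_neg_def delta_zero delta_diff_one_form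
          delta_neg_one_form ext_d_fun_form fun_eq_iff neg)
  qed
  let ?R = "\<lambda>p k. pdt (u k) p + (1/2) * pdx k (codiff g u) p - pdx k ?V p"
  have expand: "?D p X = (\<Sum>k\<in>UNIV. X $ k * (pdx k f p - ?R p k))" for p X
    unfolding pdt_linear_combination[OF u] ddir_expand[OF f] ddir_expand[OF c] ddir_expand[OF V]
    by (simp only: sum_distrib_left sum_subtractf sum.distrib right_diff_distrib distrib_left
        mult.left_commute)
  have "(\<forall>p X. ?D p X = 0) \<longleftrightarrow> (\<forall>p k. ?E p k)"
  proof
    assume D: "\<forall>p X. ?D p X = 0"
    show "\<forall>p k. ?E p k"
    proof (intro allI)
      fix p k
      have "(\<Sum>j\<in>UNIV. (pdx j f p - ?R p j) * (axis k 1 :: real^'n) $ j) = 0"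
        using D[THEN spec[of _ p], THEN spec[of _ "axis k 1"]] unfolding expand by (simp only: mult.commute)
      then show "?E p k" unfolding sum_axis by simp
    qed
  next
    assume "\<forall>p k. ?E p k"
    then show "\<forall>p X. ?D p X = 0"
      unfolding expand by simp
  qed
  moreover have "d_I g v (one_form u, fun_form f) = 0 \<longleftrightarrow> (\<forall>p X. ?D p X = 0)"
  proof
    assume "d_I g v (one_form u, fun_form f) = 0"
    then have eq: "(\<lambda>p Xs. if length Xs = 1 then ?D p (hd Xs) else 0) = 0"
      unfolding d by (simp add: zero_prod_def)
    show "\<forall>p X. ?D p X = 0"
    proof (intro allI)
      fix p X
      show "?D p X = 0"
        using fun_cong[OF fun_cong[OF eq, of p], of "[X]"] by simp
    qed
  next
    assume "\<forall>p X. ?D p X = 0"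
    then show "d_I g v (one_form u, fun_form f) = 0"
      unfolding d by (simp add: zero_prod_def fun_eq_iff)
  qed
  ultimately show ?thesis by blast
qed

section \<open>The 1-form \<open>\<xi>\<close>\<close>

lemma smooth_christoffel:
  assumes "\<And>i j. smooth (\<lambda>p. g p $ i $ j)" "\<And>i j. smooth (\<lambda>p. matrix_inv (g p) $ i $ j)"
  shows "smooth (christoffel g i l m)"
  unfolding christoffel_def[abs_def]
  by (intro smooth_intros smooth_pdx assms)

text \<open>The drift part of \<open>d\<^sub>I x\<^sup>i\<close> contributes \<open>- u\<^sub>i v\<^sup>i\<close> to the coefficient of \<open>dt\<close>, and the quadratic term of
  \<open>\<xi>\<close> gives back half of it because \<open>g\<^sub>i\<^sub>j v\<^sup>i v\<^sup>j = u\<^sub>i v\<^sup>i\<close>.\<close>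

lemma xi_form_eq:
  assumes "\<And>p. transpose (g p) = g p"
  shows "xi_form g v = (one_form (lower g v), fun_form (\<lambda>p.
    - (1/2) * (\<Sum>i\<in>UNIV. lower g v i p * v p $ i)
    - (1/2) * (\<Sum>i\<in>UNIV. lower g v i p * (\<Sum>l\<in>UNIV. \<Sum>m\<in>UNIV.
         matrix_inv (g p) $ l $ m * christoffel g i l m p))))"
proof -
  have q: "(\<Sum>i\<in>UNIV. \<Sum>j\<in>UNIV. g p $ i $ j * v p $ i * v p $ j) =
      (\<Sum>i\<in>UNIV. lower g v i p * v p $ i)" for p
    by (simp add: lower_def sum_distrib_right sum_distrib_left mult_ac)
  have "fst (xi_form g v) p Xs = one_form (lower g v) p Xs" for p Xs
    by (simp add: xi_form_def fst_sum sum_fun_apply scale_form_def d_I_coord[OF assms]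
        one_form_def dt_form_def)
  moreover have "snd (xi_form g v) p Xs = fun_form (\<lambda>p.
    - (1/2) * (\<Sum>i\<in>UNIV. lower g v i p * v p $ i)
    - (1/2) * (\<Sum>i\<in>UNIV. lower g v i p * (\<Sum>l\<in>UNIV. \<Sum>m\<in>UNIV.
         matrix_inv (g p) $ l $ m * christoffel g i l m p))) p Xs" for p Xs
  proof (cases "Xs = []")
    case True
    have "snd (xi_form g v) p [] = (\<Sum>i\<in>UNIV. lower g v i p * - (v p $ i + 1 / 2 *
        (\<Sum>l\<in>UNIV. \<Sum>m\<in>UNIV. matrix_inv (g p) $ l $ m * christoffel g i l m p)))
        + 1 / 2 * (\<Sum>i\<in>UNIV. lower g v i p * v p $ i)"
      by (simp add: xi_form_def snd_sum sum_fun_apply scale_form_def d_I_coord[OF assms]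
          fun_form_def dt_form_def q)
    also have "(\<Sum>i\<in>UNIV. lower g v i p * - (v p $ i + 1 / 2 * h i)) =
        - (\<Sum>i\<in>UNIV. lower g v i p * v p $ i) - 1 / 2 * (\<Sum>i\<in>UNIV. lower g v i p * h i)" for h
      by (simp add: distrib_left sum.distrib sum_negf sum_distrib_left sum_subtractf algebra_simps)
    finally show ?thesis
      by (simp add: True fun_form_def)
  qed (simp add: xi_form_def snd_sum sum_fun_apply scale_form_def d_I_coord[OF assms]
      fun_form_def dt_form_def)
  ultimately show ?thesis
    by (simp add: prod_eq_iff fun_eq_iff)
qed


text \<open>With \<open>f = - V/2 - U/2\<close> the criterion for closed forms reads
  \<open>- \<partial>\<^sub>k V/2 - \<partial>\<^sub>k U/2 = \<partial>\<^sub>t u\<^sub>k + \<partial>\<^sub>k T/2 - \<partial>\<^sub>k U/2 - \<partial>\<^sub>k V\<close>. The terms in \<open>U\<close> cancel, so no derivative of a Christoffel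
  symbol survives; the rest is the product rule for \<open>T\<close> and \<open>V\<close>. The vanishing curl moves the index \<open>k\<close>
  from the derivative to the covector: \<open>\<partial>\<^sub>k \<partial>\<^sub>n u\<^sub>m = \<partial>\<^sub>n \<partial>\<^sub>m u\<^sub>k\<close> and \<open>v\<^sup>i \<partial>\<^sub>k u\<^sub>i = v\<^sup>i \<partial>\<^sub>i u\<^sub>k\<close>.\<close>

lemma d_I_xi_form_iff:
  assumes sym: "\<And>p. transpose (g p) = g p"
    and g: "\<And>i j. smooth (\<lambda>p. g p $ i $ j)"
    and ginv: "\<And>i j. smooth (\<lambda>p. matrix_inv (g p) $ i $ j)"
    and v: "\<And>i. smooth (\<lambda>p. v p $ i)"
    and closed: "\<forall>p i l. 0 = pdx l (lower g v i) p - pdx i (lower g v l) p"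
  shows "d_I g v (xi_form g v) = 0 \<longleftrightarrow> (\<forall>p k.
       (1/2) * (\<Sum>m\<in>UNIV. \<Sum>n\<in>UNIV. matrix_inv (g p) $ m $ n * pdx n (pdx m (lower g v k)) p) =
       - (1/2) * (\<Sum>m\<in>UNIV. \<Sum>n\<in>UNIV.
            pdx k (\<lambda>q. matrix_inv (g q) $ m $ n) p * pdx n (lower g v m) p)
       + (1/2) * (\<Sum>i\<in>UNIV. \<Sum>j\<in>UNIV. g p $ i $ j * v p $ j * pdx k (\<lambda>q. v q $ i) p)
       + (1/2) * (\<Sum>i\<in>UNIV. v p $ i * pdx i (lower g v k) p)
       - pdt (lower g v k) p)"
proof -
  define u where "u = lower g v"
  define h where "h = (\<lambda>i p. \<Sum>l\<in>UNIV. \<Sum>m\<in>UNIV. matrix_inv (g p) $ l $ m * christoffel g i l m p)"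
  define T where "T = (\<lambda>p. \<Sum>m\<in>UNIV. \<Sum>n\<in>UNIV. matrix_inv (g p) $ m $ n * pdx n (u m) p)"
  define U where "U = (\<lambda>p. \<Sum>i\<in>UNIV. u i p * h i p)"
  define V where "V = (\<lambda>p. \<Sum>i\<in>UNIV. u i p * v p $ i)"
  have u: "smooth (u k)" for k
    unfolding u_def lower_def[abs_def] by (intro smooth_intros g v)
  have h: "smooth (h k)" for k
    unfolding h_def by (intro smooth_intros smooth_christoffel g ginv)
  have T: "smooth T" unfolding T_def by (intro smooth_intros smooth_pdx ginv u)
  have U: "smooth U" unfolding U_def by (intro smooth_intros u h)
  have V: "smooth V" unfolding V_def by (intro smooth_intros u v)
  have curl: "pdx i (u j) = pdx j (u i)" for i j
    using closed by (auto simp: fun_eq_iff u_def)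

  \<comment> \<open>\<open>codiff\<close> contracts \<open>\<Gamma>\<^sup>i\<^sub>\<nu>\<^sub>\<mu>\<close>, while \<open>d\<^sub>I x\<^sup>i\<close> contracts \<open>\<Gamma>\<^sup>i\<^sub>\<mu>\<^sub>\<nu>\<close> with the same \<open>g\<^sup>\<mu>\<^sup>\<nu>\<close>; torsion-freeness identifies the two.\<close>
  have codiff: "codiff g u = (\<lambda>p. T p - U p)"
  proof
    fix p
    have "(\<Sum>\<mu>\<in>UNIV. \<Sum>\<nu>\<in>UNIV. \<Sum>i\<in>UNIV. matrix_inv (g p) $ \<mu> $ \<nu> * (u i p * christoffel g i \<nu> \<mu> p)) =
        (\<Sum>i\<in>UNIV. \<Sum>\<mu>\<in>UNIV. \<Sum>\<nu>\<in>UNIV. matrix_inv (g p) $ \<mu> $ \<nu> * (u i p * christoffel g i \<mu> \<nu> p))"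
      (is "(\<Sum>\<mu>\<in>UNIV. \<Sum>\<nu>\<in>UNIV. \<Sum>i\<in>UNIV. ?F \<mu> \<nu> i) = _")
    proof -
      have "(\<Sum>\<mu>\<in>UNIV. \<Sum>\<nu>\<in>UNIV. \<Sum>i\<in>UNIV. ?F \<mu> \<nu> i) = (\<Sum>\<mu>\<in>UNIV. \<Sum>i\<in>UNIV. \<Sum>\<nu>\<in>UNIV. ?F \<mu> \<nu> i)"
        by (intro sum.cong refl sum.swap)
      also have "\<dots> = (\<Sum>i\<in>UNIV. \<Sum>\<mu>\<in>UNIV. \<Sum>\<nu>\<in>UNIV. ?F \<mu> \<nu> i)"
        by (rule sum.swap)
      also have "\<dots> = (\<Sum>i\<in>UNIV. \<Sum>\<mu>\<in>UNIV. \<Sum>\<nu>\<in>UNIV.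
          matrix_inv (g p) $ \<mu> $ \<nu> * (u i p * christoffel g i \<mu> \<nu> p))"
        by (intro sum.cong refl arg_cong2[where f = "(*)"] christoffel_sym sym)
      finally show ?thesis .
    qed
    then show "codiff g u p = T p - U p"
      by (simp add: codiff_def T_def U_def h_def right_diff_distrib sum_subtractf
          sum_distrib_left mult.left_commute)
  qed

  have xi: "xi_form g v = (one_form u, fun_form (\<lambda>p. - (1/2) * V p - (1/2) * U p))"
    unfolding xi_form_eq[OF sym] by (simp add: u_def V_def U_def h_def)

  have f: "smooth (\<lambda>p. - (1/2) * V p - (1/2) * U p)"
    by (intro smooth_intros U V)
  have pf: "pdx k (\<lambda>p. - (1/2) * V p - (1/2) * U p) p = - (1/2) * pdx k V p - (1/2) * pdx k U p" for k p
    unfolding pdx_def by (simp only: ddir_diff ddir_cmult smooth_intros U V)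
  have pc: "pdx k (\<lambda>p. T p - U p) p = pdx k T p - pdx k U p" for k p
    by (simp add: pdx_def ddir_diff T U)

  have pV: "pdx k V p = (\<Sum>i\<in>UNIV. \<Sum>j\<in>UNIV. g p $ i $ j * v p $ j * pdx k (\<lambda>q. v q $ i) p)
      + (\<Sum>i\<in>UNIV. v p $ i * pdx i (u k) p)" for k p
  proof -
    have "pdx k V p = (\<Sum>i\<in>UNIV. u i p * pdx k (\<lambda>q. v q $ i) p + pdx k (u i) p * v p $ i)"
      unfolding V_def pdx_def using u v by (simp add: ddir_sum ddir_mult smooth_mult)
    also have "\<dots> = (\<Sum>i\<in>UNIV. u i p * pdx k (\<lambda>q. v q $ i) p) + (\<Sum>i\<in>UNIV. v p $ i * pdx i (u k) p)"
      by (simp add: sum.distrib curl[of k] mult.commute)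
    finally show ?thesis
      by (simp add: u_def lower_def[of _ _ _ p] sum_distrib_right)
  qed

  have pT: "pdx k T p =
      (\<Sum>m\<in>UNIV. \<Sum>n\<in>UNIV. matrix_inv (g p) $ m $ n * pdx n (pdx m (u k)) p)
      + (\<Sum>m\<in>UNIV. \<Sum>n\<in>UNIV. pdx k (\<lambda>q. matrix_inv (g q) $ m $ n) p * pdx n (u m) p)" for k p
  proof -
    have "pdx k T p = (\<Sum>m\<in>UNIV. \<Sum>n\<in>UNIV. matrix_inv (g p) $ m $ n * pdx k (pdx n (u m)) p
        + pdx k (\<lambda>q. matrix_inv (g q) $ m $ n) p * pdx n (u m) p)"
      unfolding T_def pdx_def[of k] using ginv smooth_pdx[OF u]
      by (simp add: ddir_sum ddir_mult smooth_mult smooth_sum)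
    moreover have "pdx k (pdx n (u m)) p = pdx n (pdx m (u k)) p" for m n
      by (simp only: pdx_commute[OF u, of k] curl[of k])
    ultimately show ?thesis
      by (simp add: sum.distrib)
  qed

  have "ext_d (one_form u) = 0"
    using closed closed_one_form_iff[OF u] by (simp add: u_def)
  moreover have "smooth (codiff g u)"
    unfolding codiff by (intro smooth_diff T U)
  ultimately have "d_I g v (xi_form g v) = 0 \<longleftrightarrow> (\<forall>p k.
      - (1/2) * pdx k V p - (1/2) * pdx k U p =
        pdt (u k) p + (1/2) * (pdx k T p - pdx k U p) - pdx k V p)"
    unfolding xi by (simp only: d_I_closed_one_form[OF _ u f v] pf pc codiff flip: V_def)
  also have "\<dots> \<longleftrightarrow> (\<forall>p k. (1/2) * pdx k T p = (1/2) * pdx k V p - pdt (u k) p)"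
    by (intro iff_allI) (auto simp: field_simps)
  finally show ?thesis
    unfolding pT pV u_def[symmetric] by (simp add: algebra_simps)
qed

theorem mainTheorem5:
  fixes v :: "(real^'n) \<times> real \<Rightarrow> real^'n"
    and \<sigma> a g :: "(real^'n) \<times> real \<Rightarrow> real^'n^'n"
  assumes "smooth v"
    and "smooth \<sigma>"
    and "\<And>p. invertible (\<sigma> p)"
    and "\<And>p. a p = \<sigma> p ** transpose (\<sigma> p)"
    and "\<And>p. g p = matrix_inv (a p)"
  shows "d_I g v (xi_form g v) = 0 \<longleftrightarrow>
    (\<forall>p k.
       (1/2) * (\<Sum>m\<in>UNIV. \<Sum>n\<in>UNIV. matrix_inv (g p) $ m $ n * pdx n (pdx m (lower g v k)) p) =
       - (1/2) * (\<Sum>m\<in>UNIV. \<Sum>n\<in>UNIV.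
            pdx k (\<lambda>q. matrix_inv (g q) $ m $ n) p * pdx n (lower g v m) p)
       + (1/2) * (\<Sum>i\<in>UNIV. \<Sum>j\<in>UNIV. g p $ i $ j * v p $ j * pdx k (\<lambda>q. v q $ i) p)
       + (1/2) * (\<Sum>i\<in>UNIV. v p $ i * pdx i (lower g v k) p)
       - pdt (lower g v k) p) \<and>
    (\<forall>p i l. 0 = pdx l (lower g v i) p - pdx i (lower g v l) p)"
proof -
  have inv: "invertible (a p)" for p
    unfolding assms(4) using assms(3)[of p]
    by (intro invertible_mult) (simp_all add: invertible_det_nz)
  have ga: "matrix_inv (g p) = a p" for p
    unfolding assms(5) by (intro matrix_inv_unique matrix_inv_inverse inv)
  have sym_a: "transpose (a p) = a p" for p
    by (simp add: assms(4) matrix_transpose_mul)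
  have sym: "transpose (g p) = g p" for p
  proof -
    have "a p ** transpose (g p) = transpose (g p ** a p)"
      by (simp add: matrix_transpose_mul sym_a)
    also have "\<dots> = mat 1"
      by (simp add: assms(5) matrix_inv_inverse[OF inv])
    finally show ?thesis
      unfolding assms(5) by (rule matrix_inv_unique[symmetric])
  qed
  have v: "smooth (\<lambda>p. v p $ i)" for i
    by (rule smooth_vec_nth[OF assms(1)])
  have \<sigma>: "smooth (\<lambda>p. \<sigma> p $ i $ j)" for i j
    by (rule smooth_vec_nth[OF smooth_vec_nth[OF assms(2)]])
  have a: "smooth (\<lambda>p. a p $ i $ j)" for i j
    unfolding assms(4) matrix_matrix_mult_def transpose_def
    by (simp add: smooth_intros \<sigma>)
  have g: "smooth (\<lambda>p. g p $ i $ j)" for i j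
    unfolding assms(5) by (rule smooth_matrix_inv[OF a inv])
  have ginv: "smooth (\<lambda>p. matrix_inv (g p) $ i $ j)" for i j
    unfolding ga by (rule a)
  have lower: "smooth (lower g v k)" for k
    unfolding lower_def[abs_def] by (intro smooth_intros g v)
  have "\<forall>p i l. 0 = pdx l (lower g v i) p - pdx i (lower g v l) p" if "d_I g v (xi_form g v) = 0"
  proof -
    have "ext_d (one_form (lower g v)) = 0"
      using that by (simp add: xi_form_eq[OF sym] d_I_def zero_prod_def)
    then show ?thesis
      unfolding closed_one_form_iff[OF lower] .
  qed
  then show ?thesis
    using d_I_xi_form_iff[OF sym g ginv v] by blast
qed

end
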